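(* For integers $d\geq5$ and $3\leq k<d$ put \[ C_{d,k}=2^d\left\{d+\frac38-\frac12\left(k+\frac dk\right)+\left(\frac dk-1\right)\left(2^{-k}-2^{1-d}\right)\right\}-1, \] and let $C_d=\max_{3\leq k<d}C_{d,k}$, the maximum being over integers $k$. Then, as $d\to\infty$, \[ C_d=\left(d-\sqrt d+O(1)\right)2^d. \] Moreover, for every integer $d\geq7$, \[ C_d<\left(d-\sqrt d+1\right)2^d. \]
   Context: The $O(1)$ denotes a quantity bounded in absolute value by an absolute constant. *)

theory Defs
  imports Complex_Main
begin

definition C_dk :: "nat \<Rightarrow> nat \<Rightarrow> real" where
  "C_dk d k = 2 ^ d * (real d + 3 / 8 - 1 / 2 * (real k + real d / real k)
     + (real d / real k - 1) * (2 powi (- int k) - 2 powi (1 - int d))) - 1"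

(* Meaningful for d \<ge> 4 only: otherwise the index set is empty and Max is unspecified. *)
definition C_max :: "nat \<Rightarrow> real" where
  "C_max d = (MAX k\<in>{3..<d}. C_dk d k)"

end

theory Submission
  imports Defs
begin

text \<open>
  Divide by \<open>2 ^ d\<close> and write \<open>q = d / k\<close>. The main part \<open>d - (k + q) / 2\<close> is at most
  \<open>d - sqrt d\<close>, because \<open>sqrt d = sqrt (k q)\<close> is the geometric mean of \<open>k\<close> and \<open>q\<close>, and it is
  close to \<open>d - sqrt d\<close> when \<open>k\<close> is close to \<open>sqrt d\<close>. So two things have to be shown.

  Upper bound: the correction \<open>(q - 1) (2^(-k) - 2^(1-d))\<close> is not bounded by itself, since
  \<open>q\<close> is as large as \<open>d / 3\<close> when \<open>k = 3\<close>. But it is at most \<open>(q - 1) t\<close> with \<open>t = 2^(-k)\<close>, and the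
  linear term \<open>q t\<close> can be absorbed into the term \<open>- q / 2\<close>: the weighted inequality of means
  \<open>sqrt (k q) \<le> a q + k / (4 a)\<close> with \<open>a = 1/2 - t\<close> loses only \<open>k / (4 a) - k / 2\<close>, which is at
  most \<open>1/2\<close> since \<open>k t \<le> 3/8\<close> and \<open>t \<le> 1/8\<close> for \<open>k \<ge> 3\<close>. Together with the constant \<open>3/8\<close> this
  stays below \<open>1\<close> (lemma \<open>C_dk_less\<close>).

  Lower bound: for \<open>3 \<le> k < d\<close> the correction is nonnegative, and for the integer
  \<open>k = \<lfloor>sqrt d\<rfloor> + 1\<close> the defect \<open>(k + q) / 2 - sqrt d = (k - sqrt d)^2 / (2 k)\<close> is at most \<open>1/6\<close>,
  which is less than \<open>3/8\<close> (lemma \<open>exists_C_dk_ge\<close>).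

  Hence the error term lies in the interval from \<open>0\<close> to \<open>1\<close> for every \<open>d \<ge> 5\<close>.
\<close>

lemma mult_power_half_le:
  fixes k :: nat
  assumes "k \<ge> 3"
  shows "real k * (1 / 2) ^ k \<le> 3 / 8"
  using assms
proof (induction k rule: dec_induct)
  case base
  show ?case by (simp add: eval_nat_numeral)
next
  case (step n)
  have "real (Suc n) \<le> 2 * real n" using step.hyps by simp
  then have "real (Suc n) * (1 / 2) ^ Suc n \<le> 2 * real n * (1 / 2) ^ Suc n"
    by (intro mult_right_mono) auto
  also have "\<dots> = real n * (1 / 2) ^ n" by simp
  finally show ?case using step.IH by linarith
qed

lemma powi_one_minus_nat: "2 powi (1 - int d) = (2 :: real) * (1 / 2) ^ d"
  by (simp add: power_int_diff power_one_over)

lemma sqrt_mult_le_weighted_mean: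
  fixes a x y :: real
  assumes "a > 0" "x \<ge> 0" "y \<ge> 0"
  shows "sqrt (x * y) \<le> a * y + x / (4 * a)"
proof -
  have "sqrt (x * y) = sqrt ((2 * a * y) * (x / (2 * a)))"
    using assms by (simp add: field_simps)
  also have "\<dots> \<le> (2 * a * y + x / (2 * a)) / 2"
    using assms by (intro arith_geo_mean_sqrt) auto
  also have "\<dots> = a * y + x / (4 * a)"
    by (simp add: field_simps)
  finally show ?thesis .
qed

text \<open>
  The weight \<open>a = 1/2 - t\<close> is forced: it is what remains of the coefficient of \<open>q\<close> once \<open>q t\<close>
  has been absorbed, so that the bound holds uniformly in \<open>q\<close>.
\<close>

lemma sqrt_mult_add_le:
  fixes k q t :: real
  assumes "k \<ge> 0" "q \<ge> 0" "t \<ge> 0" "t \<le> 1 / 8" "k * t \<le> 3 / 8"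
  shows "sqrt (k * q) + q * t \<le> (k + q) / 2 + 1 / 2"
proof -
  define a where "a = 1 / 2 - t"
  have a: "a \<ge> 3 / 8" using assms by (simp add: a_def)
  have "k / (4 * a) \<le> k / 2 + 1 / 2"
    using a assms by (simp add: a_def field_simps)
  moreover have "sqrt (k * q) \<le> a * q + k / (4 * a)"
    using a assms by (intro sqrt_mult_le_weighted_mean) auto
  ultimately show ?thesis
    by (simp add: a_def algebra_simps add_divide_distrib)
qed

lemma C_dk_less:
  assumes "3 \<le> k" "k < d"
  shows "C_dk d k < (real d - sqrt (real d) + 1) * 2 ^ d"
proof -
  define q where "q = real d / real k"
  define t :: real where "t = (1 / 2) ^ k"
  have q: "q \<ge> 1" and d: "real d = real k * q"
    using assms by (auto simp: q_def field_simps)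
  have t: "0 \<le> t" "t \<le> 1 / 8"
    using power_decreasing[of 3 k "1 / 2 :: real"] assms
    by (auto simp: t_def eval_nat_numeral)
  have "sqrt (real d) + q * t \<le> (real k + q) / 2 + 1 / 2"
    unfolding d using q t mult_power_half_le[OF assms(1)]
    by (intro sqrt_mult_add_le) (auto simp: t_def)
  moreover have "(q - 1) * (t - 2 powi (1 - int d)) \<le> q * t"
  proof -
    have "(q - 1) * (t - 2 powi (1 - int d)) \<le> (q - 1) * t"
      using q by (intro mult_left_mono) (auto simp: powi_one_minus_nat)
    also have "\<dots> \<le> q * t" using t by (simp add: left_diff_distrib)
    finally show ?thesis .
  qed
  ultimately have "real d + 3 / 8 - 1 / 2 * (real k + q) + (q - 1) * (t - 2 powi (1 - int d))
      \<le> real d - sqrt (real d) + 1"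
    by argo
  then have "2 ^ d * (real d + 3 / 8 - 1 / 2 * (real k + q)
      + (q - 1) * (t - 2 powi (1 - int d))) \<le> 2 ^ d * (real d - sqrt (real d) + 1)"
    by (intro mult_left_mono) auto
  moreover have "C_dk d k = 2 ^ d * (real d + 3 / 8 - 1 / 2 * (real k + q)
      + (q - 1) * (t - 2 powi (1 - int d))) - 1"
    by (simp add: C_dk_def q_def t_def power_int_minus power_one_over field_simps)
  ultimately show ?thesis by (subst mult.commute) linarith
qed

lemma half_sum_quotient_le_sqrt:
  fixes k d :: real
  assumes "k \<ge> 3" "d \<ge> 0" "\<bar>k - sqrt d\<bar> \<le> 1"
  shows "1 / 2 * (k + d / k) \<le> sqrt d + 1 / 6"
proof -
  have "(k - sqrt d)\<^sup>2 \<le> 1" using assms by (simp add: abs_square_le_1)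
  then have "k * k + d \<le> 2 * k * sqrt d + k / 3"
    using assms by (simp add: power2_eq_square algebra_simps)
  then show ?thesis using assms by (simp add: field_simps)
qed

lemma exists_C_dk_ge:
  assumes "d \<ge> 5"
  shows "\<exists>k\<in>{3..<d}. (real d - sqrt (real d)) * 2 ^ d \<le> C_dk d k"
proof
  define k where "k = nat \<lfloor>sqrt (real d)\<rfloor> + 1"
  have k: "real k > sqrt (real d)" "real k \<le> sqrt (real d) + 1"
    by (simp_all add: k_def) linarith+
  have "sqrt (real d) > 2" using assms by (intro real_less_rsqrt) auto
  with k have k3: "k \<ge> 3" by linarith
  have "sqrt (real d) + 1 < real d"
  proof -
    have "2 * sqrt (real d) < sqrt (real d) * sqrt (real d)"
      using \<open>sqrt (real d) > 2\<close> assms by (intro mult_strict_right_mono) auto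
    then show ?thesis using \<open>sqrt (real d) > 2\<close> by simp
  qed
  with k have kd: "k < d" by linarith
  show "k \<in> {3..<d}" using k3 kd by simp
  define corr :: real where
    "corr = (real d / real k - 1) * (2 powi (- int k) - 2 powi (1 - int d))"
  have "corr \<ge> 0"
    unfolding corr_def using k3 kd by (intro mult_nonneg_nonneg) (auto intro: power_int_increasing)
  moreover have "1 / 2 * (real k + real d / real k) \<le> sqrt (real d) + 1 / 6"
    using k k3 by (intro half_sum_quotient_le_sqrt) auto
  ultimately have "real d - sqrt (real d) + 1 / 8
      \<le> real d + 3 / 8 - 1 / 2 * (real k + real d / real k) + corr"
    by linarith
  then have "2 ^ d * (real d - sqrt (real d) + 1 / 8)
      \<le> 2 ^ d * (real d + 3 / 8 - 1 / 2 * (real k + real d / real k) + corr)"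
    by (intro mult_left_mono) auto
  \<comment> \<open>The slack of \<open>1/8\<close> pays for the final \<open>- 1\<close> in \<open>C_dk\<close>, because \<open>2 ^ d \<ge> 8\<close>.\<close>
  moreover have "(2 :: real) ^ d \<ge> 2 ^ 3"
    using assms by (intro power_increasing) auto
  ultimately show "(real d - sqrt (real d)) * 2 ^ d \<le> C_dk d k"
    unfolding C_dk_def corr_def[symmetric] by (simp add: algebra_simps)
qed

lemma C_max_less:
  assumes "d \<ge> 5"
  shows "C_max d < (real d - sqrt (real d) + 1) * 2 ^ d"
  unfolding C_max_def using assms by (subst Max_less_iff) (auto intro: C_dk_less)

lemma C_max_ge:
  assumes "d \<ge> 5"
  shows "(real d - sqrt (real d)) * 2 ^ d \<le> C_max d"
  unfolding C_max_def using exists_C_dk_ge[OF assms] assms by (subst Max_ge_iff) auto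

theorem corollary1p2:
  shows "(\<exists>(K::real) (E::nat \<Rightarrow> real). \<forall>d\<ge>5. \<bar>E d\<bar> \<le> K \<and>
            C_max d = (real d - sqrt (real d) + E d) * 2 ^ d)
       \<and> (\<forall>d\<ge>7. C_max d < (real d - sqrt (real d) + 1) * 2 ^ d)"
proof
  define E where "E d = C_max d / 2 ^ d - (real d - sqrt (real d))" for d
  have "\<bar>E d\<bar> \<le> 1 \<and> C_max d = (real d - sqrt (real d) + E d) * 2 ^ d" if "d \<ge> 5" for d
  proof
    have "C_max d / 2 ^ d < real d - sqrt (real d) + 1"
      using C_max_less[OF that] by (simp add: pos_divide_less_eq)
    moreover have "real d - sqrt (real d) \<le> C_max d / 2 ^ d"
      using C_max_ge[OF that] by (simp add: pos_le_divide_eq)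
    ultimately show "\<bar>E d\<bar> \<le> 1" unfolding E_def by linarith
    show "C_max d = (real d - sqrt (real d) + E d) * 2 ^ d" by (simp add: E_def)
  qed
  then show "\<exists>(K::real) (E::nat \<Rightarrow> real). \<forall>d\<ge>5. \<bar>E d\<bar> \<le> K \<and>
      C_max d = (real d - sqrt (real d) + E d) * 2 ^ d"
    by blast
  show "\<forall>d\<ge>7. C_max d < (real d - sqrt (real d) + 1) * 2 ^ d"
    using C_max_less by simp
qed

end
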